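(* Let $A$ be a $k\times k$ nonsingular complex matrix, and let $\chi_A(x)=(x-\alpha_1)^{m_1}(x-\alpha_2)^{m_2}\cdots(x-\alpha_s)^{m_s}$ be its characteristic polynomial, where $\alpha_1,\ldots,\alpha_s$ are distinct and $m_1,\ldots,m_s\ge 1$. Let $\beta_1,\ldots,\beta_s\in\mathbb{C}$ be such that $\alpha_1=e^{\beta_1},\ldots,\alpha_s=e^{\beta_s}$. Put $B_{pj}=L_{pj}(A)[\chi_A]$ for $1\le p\le s$, $0\le j\le m_p-1$. Then the matrix $$\sum_{p=1}^{s}\beta_pB_{p0}+\sum_{p=1}^{s}\sum_{j=1}^{m_p-1}\frac{(-1)^{j-1}}{j\,\alpha_p^{j}}B_{pj}$$ is a logarithm of $A$.
   Context: For a non-constant polynomial $P(x)=(x-\alpha_1)^{m_1}\cdots(x-\alpha_s)^{m_s}$ with $\alpha_1,\ldots,\alpha_s\in\mathbb{C}$ distinct, set, for $1\le j\le s$, $P_j(x)=\prod_{i\ne j}(x-\alpha_i)^{m_i}=P(x)/(x-\alpha_j)^{m_j}$ and $g_j(x)=1/P_j(x)$. For $1\le j\le s$ and $0\le r\le m_j-1$ define the polynomial $$L_{jr}(x)[P]=P_j(x)(x-\alpha_j)^{r}\sum_{i=0}^{m_j-1-r}\frac{1}{i!}g_j^{(i)}(\alpha_j)(x-\alpha_j)^i.$$ $L_{jr}(A)[P]$ denotes the evaluation of this polynomial at the matrix $A$. A logarithm of $A$ is a matrix $X$ with $e^{X}=A$. Empty sums are zero. *)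

theory Defs
  imports "HOL-Analysis.Analysis" "HOL-Computational_Algebra.Polynomial"
begin

text \<open>The product of the type \<open>'a ^ 'n\<close> is componentwise, so the power operator of the
  library does not give powers of a matrix with respect to \<open>**\<close>; likewise \<open>*s\<close> scales by
  an element of the component type, which for a matrix is a row.\<close>

primrec mat_power :: "('a::semiring_1) ^ 'n ^ 'n \<Rightarrow> nat \<Rightarrow> 'a ^ 'n ^ 'n" where
  "mat_power A 0 = mat 1"
| "mat_power A (Suc n) = A ** mat_power A n"

definition mat_scale :: "'a::semiring_1 \<Rightarrow> 'a ^ 'n ^ 'm \<Rightarrow> 'a ^ 'n ^ 'm" (infixr "*\<^sub>M" 75) where
  "c *\<^sub>M A = (\<chi> i j. c * A $ i $ j)"

definition mat_poly :: "('a::comm_ring_1) poly \<Rightarrow> 'a ^ 'n ^ 'n \<Rightarrow> 'a ^ 'n ^ 'n" where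
  "mat_poly p A = (\<Sum>i\<le>degree p. coeff p i *\<^sub>M mat_power A i)"

definition charpoly :: "('a::comm_ring_1) ^ 'n ^ 'n \<Rightarrow> 'a poly" where
  "charpoly A = det (mat [:0, 1:] - map_matrix (\<lambda>c. [:c:]) A)"

definition mat_exp :: "complex ^ 'n ^ 'n \<Rightarrow> complex ^ 'n ^ 'n" where
  "mat_exp X = (\<Sum>n. (1 / fact n) *\<^sub>R mat_power X n)"

lemma norm_mat_power_entry_le:
  fixes X :: "complex ^ 'n ^ 'n"
  assumes "\<And>i j. norm (X $ i $ j) \<le> c"
  shows "norm (mat_power X n $ i $ j) \<le> (real CARD('n) * c) ^ n"
proof (induction n arbitrary: i j)
  case 0
  then show ?case by (simp add: mat_def)
next
  case (Suc n)
  have c0: "0 \<le> c" using assms norm_ge_zero order_trans by blast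
  have "norm (mat_power X (Suc n) $ i $ j) \<le> (\<Sum>k\<in>UNIV. norm (X $ i $ k * mat_power X n $ k $ j))"
    by (simp add: matrix_matrix_mult_def norm_sum)
  also have "\<dots> \<le> (\<Sum>k\<in>(UNIV::'n set). c * (real CARD('n) * c) ^ n)"
    by (intro sum_mono) (simp add: norm_mult mult_mono assms Suc c0)
  finally show ?case by (simp add: algebra_simps)
qed

text \<open>The exponential series converges, so that \<^const>\<open>suminf\<close> in the definition of
  \<^const>\<open>mat_exp\<close> is a genuine limit.\<close>

lemma mat_exp_sums:
  fixes X :: "complex ^ 'n ^ 'n"
  shows "(\<lambda>n. (1 / fact n) *\<^sub>R mat_power X n) sums mat_exp X"
proof -
  define c where "c = (\<Sum>i\<in>UNIV. \<Sum>j\<in>UNIV. norm (X $ i $ j))"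
  define N where "N = real CARD('n)"
  have c: "norm (X $ i $ j) \<le> c" for i j
  proof -
    have "norm (X $ i $ j) \<le> (\<Sum>j\<in>UNIV. norm (X $ i $ j))"
      by (rule member_le_sum) auto
    also have "\<dots> \<le> c" unfolding c_def
      by (rule member_le_sum) (auto intro: sum_nonneg)
    finally show ?thesis .
  qed
  have bound: "norm (mat_power X n) \<le> N * (N * (N * c) ^ n)" for n
  proof -
    have "norm (mat_power X n) \<le> (\<Sum>i\<in>UNIV. norm (mat_power X n $ i))"
      unfolding norm_vec_def[of "mat_power X n"] by (rule L2_set_le_sum) auto
    also have "\<dots> \<le> (\<Sum>i\<in>UNIV. \<Sum>j\<in>UNIV. norm (mat_power X n $ i $ j))"
    proof (rule sum_mono)
      fix i
      show "norm (mat_power X n $ i) \<le> (\<Sum>j\<in>UNIV. norm (mat_power X n $ i $ j))"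
        unfolding norm_vec_def[of "mat_power X n $ i"] by (rule L2_set_le_sum) auto
    qed
    also have "\<dots> \<le> (\<Sum>i\<in>(UNIV::'n set). \<Sum>j\<in>(UNIV::'n set). (N * c) ^ n)"
      unfolding N_def by (intro sum_mono norm_mat_power_entry_le c)
    finally show ?thesis by (simp add: N_def)
  qed
  have "summable (\<lambda>n. (1 / fact n) *\<^sub>R mat_power X n)"
  proof (rule summable_comparison_test')
    show "summable (\<lambda>n. (N * N) * (inverse (fact n) * (N * c) ^ n))"
      by (intro summable_mult summable_exp)
    show "norm ((1 / fact n) *\<^sub>R mat_power X n) \<le> (N * N) * (inverse (fact n) * (N * c) ^ n)" for n
      using mult_left_mono[OF bound[of n], of "inverse (fact n)"]
      by (simp add: field_simps)
  qed
  then show ?thesis unfolding mat_exp_def by (rule summable_sums)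
qed

definition is_mat_log :: "complex ^ 'n ^ 'n \<Rightarrow> complex ^ 'n ^ 'n \<Rightarrow> bool" where
  "is_mat_log X A \<longleftrightarrow> mat_exp X = A"

text \<open>A polynomial \<open>P(x) = (x - \<alpha> 1)^m 1 \<cdots> (x - \<alpha> s)^m s\<close> enters the following definitions
  through \<open>s\<close>, \<open>\<alpha>\<close> and \<open>m\<close>; the values of \<open>\<alpha>\<close> and \<open>m\<close> outside \<open>{1..s}\<close> are irrelevant.\<close>

definition poly_of_roots :: "nat \<Rightarrow> (nat \<Rightarrow> complex) \<Rightarrow> (nat \<Rightarrow> nat) \<Rightarrow> complex poly" where
  "poly_of_roots s \<alpha> m = (\<Prod>i\<in>{1..s}. [:- \<alpha> i, 1:] ^ m i)"

definition omit_root :: "nat \<Rightarrow> (nat \<Rightarrow> complex) \<Rightarrow> (nat \<Rightarrow> nat) \<Rightarrow> nat \<Rightarrow> complex poly" where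
  "omit_root s \<alpha> m j = (\<Prod>i\<in>{1..s} - {j}. [:- \<alpha> i, 1:] ^ m i)"

definition g_fun :: "nat \<Rightarrow> (nat \<Rightarrow> complex) \<Rightarrow> (nat \<Rightarrow> nat) \<Rightarrow> nat \<Rightarrow> complex \<Rightarrow> complex" where
  "g_fun s \<alpha> m j = (\<lambda>x. 1 / poly (omit_root s \<alpha> m j) x)"

definition L_poly ::
  "nat \<Rightarrow> (nat \<Rightarrow> complex) \<Rightarrow> (nat \<Rightarrow> nat) \<Rightarrow> nat \<Rightarrow> nat \<Rightarrow> complex poly" where
  "L_poly s \<alpha> m j r =
     omit_root s \<alpha> m j * [:- \<alpha> j, 1:] ^ r *
     (\<Sum>i = 0..m j - 1 - r.
        smult (1 / fact i * (deriv ^^ i) (g_fun s \<alpha> m j) (\<alpha> j)) ([:- \<alpha> j, 1:] ^ i))"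

end

theory Submission
  imports Defs
begin

text \<open>
  The matrix \<open>X\<close> of the theorem is \<open>q(A)\<close>, where \<open>q\<close> is the polynomial whose Taylor
  coefficients at each root \<open>\<alpha> p\<close> agree below order \<open>m p\<close> with those of the branch of the
  logarithm taking the value \<open>\<beta> p\<close> there: the \<open>L_poly s \<alpha> m p j\<close> are the fundamental
  polynomials of Hermite interpolation, dual to the functionals "\<open>j\<close>-th Taylor coefficient at
  \<open>\<alpha> p\<close>" (\<open>taylor_hermite_sum\<close>).

  By the Cayley-Hamilton theorem, the value \<open>f(A)\<close> of any polynomial \<open>f\<close> depends only on \<open>f\<close>
  modulo the characteristic polynomial, that is, on finitely many Taylor coefficients of \<open>f\<close>, and
  it depends on them linearly, with the matrices \<open>B p j\<close> as coefficients
  (\<open>mat_poly_hermite_interpolation\<close>). Let \<open>E n\<close> be the sum of the first \<open>n\<close> terms of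
  the exponential series of \<open>q\<close>, again a polynomial. On the one hand \<open>E n (A)\<close> tends to
  \<open>exp (q(A))\<close>. On the other hand the Taylor coefficients of \<open>E n\<close> at \<open>\<alpha> p\<close> below
  order \<open>m p\<close> tend to those of \<open>exp (log x) = x\<close>, so \<open>E n (A)\<close> tends to \<open>A\<close>.

  The second limit is obtained without analysis of composed functions. From
  \<open>E (n+1)' = E n * q'\<close>, the limiting coefficients obey the recursion of the
  differential equation \<open>F' = F * q'\<close> with \<open>F(\<alpha> p) = exp (\<beta> p)\<close>
  (\<open>taylor_exp_partial_tendsto\<close>), and \<open>F = x\<close> solves this equation to the required order
  because \<open>x * q'\<close> is congruent to \<open>1\<close> modulo the power \<open>m p - 1\<close> of \<open>x - \<alpha> p\<close>
  (\<open>log_series_ode\<close>).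
\<close>

section \<open>The polynomial functional calculus of a matrix\<close>

lemma mat_scale_nth [simp]: "(c *\<^sub>M A) $ i $ j = c * A $ i $ j"
  by (simp add: mat_scale_def)

lemma mat_scale_zero_left [simp]: "0 *\<^sub>M A = 0"
  by (simp add: vec_eq_iff)

lemma mat_scale_one [simp]: "1 *\<^sub>M A = A"
  by (simp add: vec_eq_iff)

lemma mat_scale_mult_left:
  fixes A :: "'a::comm_ring_1 ^ 'n ^ 'm" and B :: "'a ^ 'k ^ 'n"
  shows "(c *\<^sub>M A) ** B = c *\<^sub>M (A ** B)"
  by (simp add: vec_eq_iff matrix_matrix_mult_def sum_distrib_left mult.assoc)

lemma mat_scale_mult_right:
  fixes A :: "'a::comm_ring_1 ^ 'n ^ 'm" and B :: "'a ^ 'k ^ 'n"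
  shows "A ** (c *\<^sub>M B) = c *\<^sub>M (A ** B)"
  by (simp add: vec_eq_iff matrix_matrix_mult_def sum_distrib_left mult.left_commute)

lemma mat_scale_sum: "c *\<^sub>M (\<Sum>i\<in>S. F i) = (\<Sum>i\<in>S. c *\<^sub>M F i)"
  by (simp add: vec_eq_iff sum_distrib_left)

lemma mat_scale_scale: "a *\<^sub>M b *\<^sub>M A = (a * b) *\<^sub>M A"
  by (simp add: vec_eq_iff mult.assoc)

lemma matrix_mult_sum_right:
  fixes A :: "'a::comm_ring_1 ^ 'n ^ 'm" and F :: "'i \<Rightarrow> 'a ^ 'k ^ 'n"
  shows "A ** (\<Sum>i\<in>S. F i) = (\<Sum>i\<in>S. A ** F i)"
  by (induction S rule: infinite_finite_induct) (simp_all add: matrix_add_ldistrib)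

lemma matrix_mult_add_left:
  fixes A B :: "'a::comm_ring_1 ^ 'n ^ 'm" and C :: "'a ^ 'k ^ 'n"
  shows "(A + B) ** C = A ** C + B ** C"
  by (simp add: vec_eq_iff matrix_matrix_mult_def sum.distrib distrib_right)

lemma mat_poly_eq_sum:
  assumes "degree p \<le> n"
  shows "mat_poly p A = (\<Sum>i\<le>n. coeff p i *\<^sub>M mat_power A i)"
  unfolding mat_poly_def using assms
  by (intro sum.mono_neutral_left) (auto simp: coeff_eq_0)

lemma mat_poly_0 [simp]: "mat_poly 0 A = 0"
  by (simp add: mat_poly_def)

lemma mat_poly_pCons: "mat_poly (pCons a p) A = a *\<^sub>M mat 1 + A ** mat_poly p A"
proof -
  have "mat_poly (pCons a p) A
      = (\<Sum>i\<le>Suc (degree p). coeff (pCons a p) i *\<^sub>M mat_power A i)"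
    by (rule mat_poly_eq_sum) (rule degree_pCons_le)
  then show ?thesis
    by (simp only: sum.atMost_Suc_shift)
      (simp add: mat_poly_def matrix_mult_sum_right mat_scale_mult_right)
qed

lemma mat_poly_1 [simp]: "mat_poly 1 A = mat 1"
  by (simp add: one_pCons mat_poly_pCons)

lemma mat_poly_add: "mat_poly (p + q) A = mat_poly p A + mat_poly q A"
proof -
  let ?n = "max (degree p) (degree q)"
  have "mat_poly (p + q) A = (\<Sum>i\<le>?n. coeff (p + q) i *\<^sub>M mat_power A i)"
    by (rule mat_poly_eq_sum) (rule degree_add_le_max)
  also have "\<dots> = (\<Sum>i\<le>?n. coeff p i *\<^sub>M mat_power A i) + (\<Sum>i\<le>?n. coeff q i *\<^sub>M mat_power A i)"
    by (simp add: vec_eq_iff sum.distrib[symmetric] distrib_right)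
  finally show ?thesis
    by (simp add: mat_poly_eq_sum[of p ?n] mat_poly_eq_sum[of q ?n])
qed

lemma mat_poly_smult: "mat_poly (smult c p) A = c *\<^sub>M mat_poly p A"
  unfolding mat_poly_eq_sum[OF degree_smult_le]
  by (simp add: mat_poly_def mat_scale_sum mat_scale_scale)

lemma mat_poly_sum: "mat_poly (\<Sum>i\<in>S. f i) A = (\<Sum>i\<in>S. mat_poly (f i) A)"
  by (induction S rule: infinite_finite_induct) (simp_all add: mat_poly_add)

lemma mat_poly_mult: "mat_poly (p * q) A = mat_poly p A ** mat_poly q A"
proof (induction p)
  case (pCons a p)
  then show ?case
    by (simp add: mat_poly_add mat_poly_smult mat_poly_pCons matrix_mult_add_left
        mat_scale_mult_left matrix_mul_assoc)
qed simp

lemma mat_poly_power: "mat_poly (p ^ k) A = mat_power (mat_poly p A) k"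
  by (induction k) (simp_all add: mat_poly_mult)


section \<open>The Cayley-Hamilton theorem\<close>

definition adjugate :: "'a::comm_ring_1 ^ 'n ^ 'n \<Rightarrow> 'a ^ 'n ^ 'n" where
  "adjugate M = (\<chi> j k. det (\<chi> i. if i = k then axis j 1 else M $ i))"

text \<open>Multilinearity of the determinant in row \<open>k\<close> turns the sum into the determinant of \<open>M\<close>
  with row \<open>k\<close> replaced by row \<open>i\<close>, which has two equal rows unless \<open>i = k\<close>.\<close>

lemma matrix_mult_adjugate:
  fixes M :: "'a::comm_ring_1 ^ 'n ^ 'n"
  shows "(\<Sum>j\<in>UNIV. M $ i $ j * adjugate M $ j $ k) = (if i = k then det M else 0)"
proof -
  have "(\<Sum>j\<in>UNIV. M $ i $ j * adjugate M $ j $ k)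
      = (\<Sum>j\<in>UNIV. det (\<chi> l. if l = k then M $ i $ j *s axis j 1 else M $ l))"
    by (simp add: adjugate_def det_row_mul)
  also have "\<dots> = det (\<chi> l. if l = k then (\<Sum>j\<in>UNIV. M $ i $ j *s axis j 1) else M $ l)"
    by (rule det_linear_row_sum[symmetric]) simp
  also have "(\<Sum>j\<in>UNIV. M $ i $ j *s axis j 1) = M $ i"
    by (rule basis_expansion)
  also have "det (\<chi> l. if l = k then M $ i else M $ l) = (if i = k then det M else 0)"
  proof (cases "i = k")
    case True
    then have "(\<chi> l. if l = k then M $ i else M $ l) = M"
      by (simp add: vec_eq_iff)
    with True show ?thesis by simp
  next
    case False
    then show ?thesis
      by (auto intro!: det_identical_rows[of i k] simp: row_def)
  qed
  finally show ?thesis .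
qed

lemma matrix_vector_mult_sum_left:
  fixes F :: "'i \<Rightarrow> 'a::comm_ring_1 ^ 'n ^ 'm"
  shows "(\<Sum>i\<in>S. F i) *v v = (\<Sum>i\<in>S. F i *v v)"
  by (induction S rule: infinite_finite_induct) (simp_all add: matrix_vector_mult_add_rdistrib)

lemma matrix_vector_mult_sum_right:
  fixes B :: "'a::comm_ring_1 ^ 'n ^ 'm"
  shows "B *v (\<Sum>i\<in>S. f i) = (\<Sum>i\<in>S. B *v f i)"
  by (induction S rule: infinite_finite_induct) (simp_all add: matrix_vector_right_distrib)

lemma matrix_vector_mult_axis: "A *v axis k 1 = column k A" for A :: "'a::comm_ring_1 ^ 'n ^ 'm"
  by (simp add: vec_eq_iff matrix_vector_mult_def column_def axis_def
      if_distrib[of "\<lambda>x. _ * x"] cong: if_cong)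

text \<open>The determinant trick: let polynomials act on vectors through \<open>A\<close>. The equation
  \<open>A e\<^sub>j = \<Sum>\<^sub>i A\<^sub>i\<^sub>j e\<^sub>i\<close> says that \<open>\<Sum>\<^sub>i M\<^sub>i\<^sub>j e\<^sub>i = 0\<close> for the polynomial
  matrix \<open>M = x I - A\<close>. Multiplying by the adjugate of \<open>M\<close> gives \<open>det M\<close> acting as zero on
  every basis vector.\<close>

theorem cayley_hamilton:
  fixes A :: "'a::comm_ring_1 ^ 'n ^ 'n"
  shows "mat_poly (charpoly A) A = 0"
proof -
  define M :: "'a poly ^ 'n ^ 'n" where "M = mat [:0, 1:] - map_matrix (\<lambda>c. [:c:]) A"
  have det_M: "det M = charpoly A" by (simp add: M_def charpoly_def)
  have M_nth: "M $ i $ j = (if i = j then [:0, 1:] else 0) - [:A $ i $ j:]" for i j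
    by (simp add: M_def mat_def map_matrix_def)
  have diff: "mat_poly (p - q) A = mat_poly p A - mat_poly q A" for p q
    using mat_poly_add[of "p - q" q A] by simp
  have entry: "mat_poly (M $ i $ j) A *v v
      = (if i = j then A *v v else 0) - A $ i $ j *s v" for i j and v :: "'a ^ 'n"
  proof -
    have "(c *\<^sub>M mat 1) *v v = c *s v" for c :: 'a
      by (simp add: vec_eq_iff matrix_vector_mult_def mat_def if_distrib[of "\<lambda>x. x * _"]
          if_distrib[of "\<lambda>x. _ * x"] cong: if_cong)
    then show ?thesis
      by (simp add: M_nth diff mat_poly_pCons matrix_vector_mult_diff_rdistrib)
  qed
  have kills: "(\<Sum>i\<in>UNIV. mat_poly (M $ i $ j) A *v axis i 1) = 0" for j
  proof -
    have "(\<Sum>i\<in>UNIV. mat_poly (M $ i $ j) A *v axis i 1)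
        = A *v axis j 1 - (\<Sum>i\<in>UNIV. A $ i $ j *s axis i 1)"
      by (simp add: entry sum_subtractf)
    also have "(\<Sum>i\<in>UNIV. A $ i $ j *s axis i 1) = column j A"
      using basis_expansion[of "column j A"] by (simp add: column_def)
    finally show ?thesis by (simp add: matrix_vector_mult_axis)
  qed
  have "mat_poly (charpoly A) A *v axis k 1 = 0" for k
  proof -
    have "mat_poly (charpoly A) A *v axis k 1
        = (\<Sum>i\<in>UNIV. mat_poly (if i = k then det M else 0) A *v axis i 1)"
      by (simp add: det_M if_distrib[of "\<lambda>p. mat_poly p A"]
          if_distrib[of "\<lambda>X. X *v _"] cong: if_cong)
    also have "\<dots> = (\<Sum>i\<in>UNIV. \<Sum>j\<in>UNIV.
        mat_poly (adjugate M $ j $ k) A *v (mat_poly (M $ i $ j) A *v axis i 1))"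
      by (simp add: matrix_mult_adjugate[symmetric] mat_poly_sum matrix_vector_mult_sum_left
          mult.commute[of "M $ _ $ _"] mat_poly_mult matrix_vector_mul_assoc)
    also have "\<dots> = (\<Sum>j\<in>UNIV. mat_poly (adjugate M $ j $ k) A *v
        (\<Sum>i\<in>UNIV. mat_poly (M $ i $ j) A *v axis i 1))"
      by (subst sum.swap) (simp add: matrix_vector_mult_sum_right)
    finally show ?thesis by (simp add: kills)
  qed
  then have "column k (mat_poly (charpoly A) A) = 0" for k
    by (simp add: matrix_vector_mult_axis)
  then show ?thesis by (simp add: vec_eq_iff column_def)
qed


section \<open>Taylor expansion of polynomials\<close>

text \<open>The Taylor series is taken algebraically, by shifting the argument, so that it is a ring
  homomorphism on sight; over the complex numbers its coefficients are the higher derivatives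
  divided by factorials.\<close>

definition taylor_at :: "'a::comm_ring_1 \<Rightarrow> 'a poly \<Rightarrow> 'a fps" where
  "taylor_at a f = fps_of_poly (f \<circ>\<^sub>p [:a, 1:])"

lemma taylor_at_simps:
  "taylor_at a (f * g) = taylor_at a f * taylor_at a g"
  "taylor_at a (smult c f) = fps_const c * taylor_at a f"
  "taylor_at a (\<Sum>i\<in>S. h i) = (\<Sum>i\<in>S. taylor_at a (h i))"
  "taylor_at a (f - g) = taylor_at a f - taylor_at a g"
  by (simp_all add: taylor_at_def pcompose_mult pcompose_smult pcompose_sum
      pcompose_diff fps_of_poly_simps fps_of_poly_sum)

lemma pcompose_power: "(f ^ k) \<circ>\<^sub>p g = (f \<circ>\<^sub>p g) ^ k" for f :: "'a::comm_ring_1 poly"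
  by (induction k) (simp_all add: pcompose_1 pcompose_mult)

lemma taylor_at_power: "taylor_at a (f ^ k) = taylor_at a f ^ k"
  by (simp add: taylor_at_def pcompose_power fps_of_poly_power)

lemma taylor_at_linear: "taylor_at a [:c, 1:] = fps_X + fps_const (c + a)"
  by (simp add: fps_eq_iff taylor_at_def pcompose_pCons coeff_pCons fps_X_def split: nat.splits)

lemma taylor_at_nth_0: "fps_nth (taylor_at a f) 0 = poly f a"
  by (simp add: taylor_at_def poly_pcompose flip: poly_0_coeff_0)

lemma linear_power_dvd_if_taylor_vanishes:
  assumes "\<And>k. k < n \<Longrightarrow> fps_nth (taylor_at a f) k = 0"
  shows "[:- a, 1:] ^ n dvd f"
proof -
  have "monom 1 n dvd f \<circ>\<^sub>p [:a, 1:]"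
    using assms by (simp add: monom_1_dvd_iff' taylor_at_def)
  then obtain h where h: "f \<circ>\<^sub>p [:a, 1:] = monom 1 n * h" ..
  have "f = (f \<circ>\<^sub>p [:a, 1:]) \<circ>\<^sub>p [:- a, 1:]"
    by (simp add: pcompose_assoc[symmetric] pcompose_pCons)
  also have "\<dots> = [:- a, 1:] ^ n * (h \<circ>\<^sub>p [:- a, 1:])"
    by (simp add: h pcompose_mult monom_altdef pcompose_power pcompose_pCons)
  finally show ?thesis by simp
qed

text \<open>Instead of coprimality of the factors, the induction uses the order of vanishing: the product
  \<open>P\<close> already split off does not vanish at the next root \<open>a\<close>, so \<open>P * h\<close> and \<open>h\<close> vanish
  there to the same order.\<close>

lemma prod_linear_powers_dvd:
  fixes f :: "'a::idom poly"
  assumes "finite S" "inj_on \<alpha> S" "\<And>i. i \<in> S \<Longrightarrow> [:- \<alpha> i, 1:] ^ m i dvd f"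
  shows "(\<Prod>i\<in>S. [:- \<alpha> i, 1:] ^ m i) dvd f"
  using assms
proof (induction S)
  case (insert a S)
  let ?P = "\<Prod>i\<in>S. [:- \<alpha> i, 1:] ^ m i"
  have "?P dvd f" using insert by simp
  then obtain h where h: "f = ?P * h" ..
  have "poly ?P (\<alpha> a) \<noteq> 0"
    using insert by (auto simp: poly_prod)
  then have "order (\<alpha> a) ?P = 0" and "?P \<noteq> 0" by (auto intro: order_0I)
  moreover have "[:- \<alpha> a, 1:] ^ m a dvd ?P * h"
    using insert.prems h by simp
  ultimately have "[:- \<alpha> a, 1:] ^ m a dvd h"
    by (cases "h = 0") (simp_all add: order_divides order_mult)
  then show ?case
    using insert.hyps h by (simp add: mult_dvd_mono mult.commute)
qed simp

lemma poly_has_fps_expansion: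
  fixes f :: "complex poly"
  shows "poly f has_fps_expansion fps_of_poly f"
  by (simp add: has_fps_expansion_def)

text \<open>Links the derivatives in the definition of \<^const>\<open>L_poly\<close>, which are analytic, to the
  formal inverse of a power series, with which the interpolation properties can be computed.\<close>

lemma taylor_coeff_recip_poly:
  fixes f :: "complex poly"
  assumes "poly f a \<noteq> 0"
  shows "(deriv ^^ i) (\<lambda>x. 1 / poly f x) a / fact i = fps_nth (inverse (taylor_at a f)) i"
proof -
  have "(\<lambda>x. inverse (poly (f \<circ>\<^sub>p [:a, 1:]) x)) has_fps_expansion inverse (taylor_at a f)"
    unfolding taylor_at_def
    using assms taylor_at_nth_0[of a f]
    by (intro has_fps_expansion_inverse poly_has_fps_expansion) (simp_all add: taylor_at_def)
  from fps_nth_fps_expansion[OF this, of i] show ?thesis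
    by (subst higher_deriv_shift_0) (simp add: o_def poly_pcompose inverse_eq_divide)
qed


section \<open>Hermite interpolation\<close>

lemma fps_mult_nth_cong:
  assumes "\<And>i. i \<le> n \<Longrightarrow> fps_nth F i = fps_nth G i"
  shows "fps_nth (H * F) n = fps_nth (H * G) n"
  using assms by (simp add: fps_mult_nth)

text \<open>With \<open>T\<close> the Taylor series of \<open>omit_root s \<alpha> m p\<close> at \<open>\<alpha> p\<close>, that of the interpolation
  polynomial is \<open>X^r * T * S\<close>, where \<open>S\<close> is \<open>1 / T\<close> cut off after degree \<open>m p - 1 - r\<close>.
  Hence \<open>T * S\<close> agrees with \<open>1\<close> far enough to make the product \<open>X^r\<close> below order
  \<open>m p\<close>.\<close>

lemma taylor_L_poly_at_own_root:
  assumes "inj_on \<alpha> {1..s}" "p \<in> {1..s}" "r < m p" "k < m p"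
  shows "fps_nth (taylor_at (\<alpha> p) (L_poly s \<alpha> m p r)) k = (if k = r then 1 else 0)"
proof -
  define P where "P = omit_root s \<alpha> m p"
  define S where "S = (\<Sum>i = 0..m p - 1 - r. fps_const (fps_nth (inverse (taylor_at (\<alpha> p) P)) i) * fps_X ^ i)"
  have P: "poly P (\<alpha> p) \<noteq> 0"
    using inj_on_eq_iff[OF assms(1) assms(2)] by (auto simp: P_def omit_root_def poly_prod)
  have "taylor_at (\<alpha> p) (L_poly s \<alpha> m p r) = taylor_at (\<alpha> p) P * fps_X ^ r * S"
    using taylor_coeff_recip_poly[OF P]
    by (simp add: L_poly_def P_def[symmetric] g_fun_def taylor_at_simps taylor_at_power
        taylor_at_linear S_def)
  also have "\<dots> = fps_X ^ r * (taylor_at (\<alpha> p) P * S)" by (simp add: mult_ac)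
  finally have L: "taylor_at (\<alpha> p) (L_poly s \<alpha> m p r) = fps_X ^ r * (taylor_at (\<alpha> p) P * S)" .
  have S_nth: "fps_nth S i = fps_nth (inverse (taylor_at (\<alpha> p) P)) i" if "i \<le> m p - 1 - r" for i
    using that by (simp add: S_def fps_sum_nth if_distrib[of "\<lambda>x. _ * x"] cong: if_cong)
  show ?thesis
  proof (cases "k < r")
    case True
    then show ?thesis by (simp add: L fps_X_power_mult_nth)
  next
    case False
    have "fps_nth (taylor_at (\<alpha> p) P * S) (k - r)
        = fps_nth (taylor_at (\<alpha> p) P * inverse (taylor_at (\<alpha> p) P)) (k - r)"
      using assms(4) by (intro fps_mult_nth_cong S_nth) linarith
    also have "\<dots> = (if k = r then 1 else 0)"
      using False P by (simp add: inverse_mult_eq_1' taylor_at_nth_0)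
    finally show ?thesis using False by (simp add: L fps_X_power_mult_nth)
  qed
qed

lemma taylor_L_poly_at_other_root:
  assumes "p' \<in> {1..s}" "p' \<noteq> p" "k < m p'"
  shows "fps_nth (taylor_at (\<alpha> p') (L_poly s \<alpha> m p r)) k = 0"
proof -
  have "[:- \<alpha> p', 1:] ^ m p' dvd omit_root s \<alpha> m p"
    unfolding omit_root_def using assms by (intro dvd_prodI[of _ _ "\<lambda>i. [:- \<alpha> i, 1:] ^ m i"]) auto
  then have "[:- \<alpha> p', 1:] ^ m p' dvd L_poly s \<alpha> m p r"
    by (simp add: L_poly_def)
  then obtain h where "L_poly s \<alpha> m p r = [:- \<alpha> p', 1:] ^ m p' * h" ..
  then show ?thesis
    using assms by (simp add: taylor_at_simps taylor_at_power taylor_at_linear fps_X_power_mult_nth)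
qed

lemma taylor_hermite_sum:
  assumes "inj_on \<alpha> {1..s}" "p \<in> {1..s}" "k < m p"
  shows "fps_nth (taylor_at (\<alpha> p) (\<Sum>t = 1..s. \<Sum>j<m t. smult (c t j) (L_poly s \<alpha> m t j))) k = c p k"
proof -
  have "fps_nth (taylor_at (\<alpha> p) (\<Sum>t = 1..s. \<Sum>j<m t. smult (c t j) (L_poly s \<alpha> m t j))) k
      = (\<Sum>t = 1..s. \<Sum>j<m t. c t j * fps_nth (taylor_at (\<alpha> p) (L_poly s \<alpha> m t j)) k)"
    by (simp add: taylor_at_simps fps_sum_nth)
  also have "\<dots> = (\<Sum>t = 1..s. if t = p then c p k else 0)"
  proof (rule sum.cong[OF refl])
    fix t assume "t \<in> {1..s}"
    show "(\<Sum>j<m t. c t j * fps_nth (taylor_at (\<alpha> p) (L_poly s \<alpha> m t j)) k)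
        = (if t = p then c p k else 0)"
    proof (cases "t = p")
      case True
      then have "(\<Sum>j<m t. c t j * fps_nth (taylor_at (\<alpha> p) (L_poly s \<alpha> m t j)) k)
          = (\<Sum>j<m p. if k = j then c p j else 0)"
        using assms by (intro sum.cong) (auto simp: taylor_L_poly_at_own_root)
      with True assms show ?thesis by simp
    next
      case False
      then show ?thesis using assms by (simp add: taylor_L_poly_at_other_root)
    qed
  qed
  finally show ?thesis using assms(2) by simp
qed

text \<open>The difference of \<open>f\<close> and its Hermite interpolant vanishes at each root of the
  characteristic polynomial to at least the multiplicity of that root, so it is a multiple of the
  characteristic polynomial and vanishes at \<open>A\<close>.\<close>

lemma mat_poly_hermite_interpolation:
  fixes A :: "complex ^ 'n ^ 'n"
  assumes "charpoly A = poly_of_roots s \<alpha> m" "inj_on \<alpha> {1..s}"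
  shows "mat_poly f A = (\<Sum>p = 1..s. \<Sum>j<m p.
           fps_nth (taylor_at (\<alpha> p) f) j *\<^sub>M mat_poly (L_poly s \<alpha> m p j) A)"
proof -
  define H where "H = (\<Sum>p = 1..s. \<Sum>j<m p.
    smult (fps_nth (taylor_at (\<alpha> p) f) j) (L_poly s \<alpha> m p j))"
  have "[:- \<alpha> p, 1:] ^ m p dvd f - H" if "p \<in> {1..s}" for p
    using taylor_hermite_sum[OF assms(2) that, of _ m "\<lambda>p. fps_nth (taylor_at (\<alpha> p) f)"]
    by (intro linear_power_dvd_if_taylor_vanishes) (simp add: taylor_at_simps H_def)
  then have "charpoly A dvd f - H"
    unfolding assms(1) poly_of_roots_def using assms(2) by (intro prod_linear_powers_dvd) auto
  then obtain h where "f - H = charpoly A * h" ..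
  then have "f = charpoly A * h + H" by (simp add: algebra_simps)
  then have "mat_poly f A = mat_poly H A"
    by (simp only: mat_poly_add mat_poly_mult cayley_hamilton) simp
  then show ?thesis by (simp add: H_def mat_poly_sum mat_poly_smult)
qed


section \<open>The exponential series of a polynomial\<close>

definition exp_partial :: "nat \<Rightarrow> complex poly \<Rightarrow> complex poly" where
  "exp_partial n q = (\<Sum>k<n. smult (1 / fact k) (q ^ k))"

lemma mat_poly_exp_partial_tendsto:
  fixes A :: "complex ^ 'n ^ 'n"
  shows "(\<lambda>n. mat_poly (exp_partial n q) A) \<longlonglongrightarrow> mat_exp (mat_poly q A)"
proof -
  have "(1 / fact k) *\<^sub>M X = (1 / fact k) *\<^sub>R X" for k and X :: "complex ^ 'n ^ 'n"
    by (simp add: vec_eq_iff scaleR_conv_of_real[where 'a = complex])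
  then have "mat_poly (exp_partial n q) A = (\<Sum>k<n. (1 / fact k) *\<^sub>R mat_power (mat_poly q A) k)" for n
    by (simp add: exp_partial_def mat_poly_sum mat_poly_smult mat_poly_power)
  with mat_exp_sums[of "mat_poly q A"] show ?thesis by (simp add: sums_def)
qed

lemma pderiv_exp_partial: "pderiv (exp_partial (Suc n) q) = exp_partial n q * pderiv q"
proof (induction n)
  case (Suc n)
  have "pderiv (smult (1 / fact (Suc n)) (q ^ Suc n)) = smult (1 / fact n) (q ^ n) * pderiv q"
    by (simp add: pderiv_smult pderiv_power_Suc divide_simps del: power_Suc of_nat_Suc)
  with Suc show ?case by (simp add: exp_partial_def pderiv_add algebra_simps del: power_Suc)
qed (simp add: exp_partial_def)

lemma fps_deriv_taylor_at: "fps_deriv (taylor_at a f) = taylor_at a (pderiv f)"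
  by (simp add: taylor_at_def fps_of_poly_pderiv[symmetric] pderiv_pcompose pderiv_pCons)

text \<open>Here \<open>F\<close> stands for the Taylor series of \<open>exp \<circ> q\<close>, characterised up to order \<open>m\<close> by its
  initial value and its differential equation. Comparing coefficients in
  \<open>E (n+1)' = E n * q'\<close> expresses coefficient \<open>j\<close> of the next partial sum through
  coefficients of lower index, so convergence propagates upwards from the scalar exponential
  series at index \<open>0\<close>.\<close>

lemma taylor_exp_partial_tendsto:
  fixes F :: "complex fps"
  assumes "fps_nth F 0 = exp (poly q a)"
    and "\<And>j. Suc j < m \<Longrightarrow>
      fps_nth (fps_deriv F) j = fps_nth (F * fps_deriv (taylor_at a q)) j"
    and "j < m"
  shows "(\<lambda>n. fps_nth (taylor_at a (exp_partial n q)) j) \<longlonglongrightarrow> fps_nth F j"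
  using assms(3)
proof (induction j rule: less_induct)
  case (less j)
  let ?c = "\<lambda>n j. fps_nth (taylor_at a (exp_partial n q)) j"
  let ?D = "fps_deriv (taylor_at a q)"
  show ?case
  proof (cases j)
    case 0
    have "(\<lambda>n. \<Sum>k<n. poly q a ^ k /\<^sub>R fact k) \<longlonglongrightarrow> exp (poly q a)"
      using exp_converges[of "poly q a"] by (simp add: sums_def)
    then show ?thesis
      by (simp add: 0 assms(1) taylor_at_nth_0 exp_partial_def poly_sum scaleR_conv_of_real
          divide_simps)
  next
    case (Suc i)
    then have j0: "of_nat j \<noteq> (0 :: complex)" by (simp del: of_nat_Suc)
    have "of_nat j * ?c (Suc n) j = (\<Sum>l = 0..i. ?c n l * fps_nth ?D (i - l))" for n
    proof -
      have "of_nat j * ?c (Suc n) j = fps_nth (fps_deriv (taylor_at a (exp_partial (Suc n) q))) i"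
        by (simp add: Suc)
      also have "\<dots> = fps_nth (taylor_at a (exp_partial n q) * ?D) i"
        by (simp add: fps_deriv_taylor_at pderiv_exp_partial taylor_at_simps)
      finally show ?thesis by (simp add: fps_mult_nth)
    qed
    then have step: "?c (Suc n) j = (\<Sum>l = 0..i. ?c n l * fps_nth ?D (i - l)) / of_nat j" for n
      using j0 by (simp add: eq_divide_eq mult.commute)
    have "(\<lambda>n. ?c (Suc n) j) \<longlonglongrightarrow> (\<Sum>l = 0..i. fps_nth F l * fps_nth ?D (i - l)) / of_nat j"
      unfolding step using less.prems Suc j0
      by (intro tendsto_intros less.IH) (auto simp del: of_nat_Suc)
    also have "(\<Sum>l = 0..i. fps_nth F l * fps_nth ?D (i - l)) = fps_nth (fps_deriv F) i"
      using assms(2)[of i] less.prems Suc by (simp add: fps_mult_nth)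
    also have "\<dots> / of_nat j = fps_nth F j"
      using Suc by (simp del: of_nat_Suc)
    finally show ?thesis by (rule LIMSEQ_imp_Suc)
  qed
qed

text \<open>The formal counterpart of \<open>x * (log x)' = 1\<close> at the point \<open>a\<close>, where \<open>x\<close> has the
  expansion \<open>X + a\<close>: the derivative of the logarithm is the geometric series
  \<open>\<Sum>\<^sub>j (-1)^j X^j / a^(j+1)\<close>. Only the coefficients of \<open>Q\<close> below \<open>m\<close> are prescribed,
  so the product is determined below \<open>m - 1\<close>.\<close>

lemma log_series_ode:
  fixes Q :: "complex fps"
  assumes "a \<noteq> 0"
    and "\<And>j. 1 \<le> j \<Longrightarrow> j < m \<Longrightarrow> fps_nth Q j = (- 1) ^ (j - 1) / (of_nat j * a ^ j)"
    and "Suc j < m"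
  shows "fps_nth ((fps_X + fps_const a) * fps_deriv Q) j = (if j = 0 then 1 else 0)"
proof -
  have D: "fps_nth (fps_deriv Q) i = (- 1) ^ i / a ^ Suc i" if "Suc i < m" for i
    using assms(2)[of "Suc i"] that by (simp del: of_nat_Suc)
  show ?thesis
  proof (cases j)
    case 0
    then show ?thesis using D[of 0] assms by (simp add: distrib_right)
  next
    case (Suc i)
    have "fps_nth ((fps_X + fps_const a) * fps_deriv Q) j
        = fps_nth (fps_deriv Q) i + a * fps_nth (fps_deriv Q) (Suc i)"
      by (simp add: distrib_right Suc)
    also have "\<dots> = 0" using D[of i] D[of "Suc i"] Suc assms(1,3)
      by (simp del: fps_deriv_nth)
    finally show ?thesis using Suc by simp
  qed
qed

section \<open>The logarithm\<close>

theorem theorem4p1: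
  fixes A :: "complex ^ 'n ^ 'n"
    and s :: nat and \<alpha> \<beta> :: "nat \<Rightarrow> complex" and m :: "nat \<Rightarrow> nat"
    and B :: "nat \<Rightarrow> nat \<Rightarrow> complex ^ 'n ^ 'n"
  assumes "invertible A"
    and "charpoly A = poly_of_roots s \<alpha> m"
    and "inj_on \<alpha> {1..s}"
    and "\<And>p. p \<in> {1..s} \<Longrightarrow> m p \<ge> 1"
    and "\<And>p. p \<in> {1..s} \<Longrightarrow> \<alpha> p = exp (\<beta> p)"
    and "\<And>p j. p \<in> {1..s} \<Longrightarrow> j \<le> m p - 1 \<Longrightarrow> B p j = mat_poly (L_poly s \<alpha> m p j) A"
  shows "is_mat_log
           ((\<Sum>p = 1..s. \<beta> p *\<^sub>M B p 0) +
            (\<Sum>p = 1..s. \<Sum>j = 1..m p - 1.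
               ((-1) ^ (j - 1) / (of_nat j * \<alpha> p ^ j)) *\<^sub>M B p j))
           A"
proof -
  define c where "c p j = (if j = 0 then \<beta> p else (- 1) ^ (j - 1) / (of_nat j * \<alpha> p ^ j))" for p j
  define q where "q = (\<Sum>p = 1..s. \<Sum>j<m p. smult (c p j) (L_poly s \<alpha> m p j))"
  note interpolation = mat_poly_hermite_interpolation[OF assms(2,3)]

  have "mat_poly q A = (\<Sum>p = 1..s. \<Sum>j<m p. c p j *\<^sub>M B p j)"
    using assms(6) by (auto simp: q_def mat_poly_sum mat_poly_smult intro!: sum.cong)
  also have "\<dots> = (\<Sum>p = 1..s. \<beta> p *\<^sub>M B p 0 + (\<Sum>j = 1..m p - 1.
               ((-1) ^ (j - 1) / (of_nat j * \<alpha> p ^ j)) *\<^sub>M B p j))"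
  proof (rule sum.cong[OF refl])
    fix p assume "p \<in> {1..s}"
    then have "{..<m p} = insert 0 {1..m p - 1}" using assms(4)[of p] by auto
    then show "(\<Sum>j<m p. c p j *\<^sub>M B p j) = \<beta> p *\<^sub>M B p 0 + (\<Sum>j = 1..m p - 1.
               ((-1) ^ (j - 1) / (of_nat j * \<alpha> p ^ j)) *\<^sub>M B p j)"
      by (auto simp: c_def intro!: sum.cong)
  qed
  finally have q_A: "mat_poly q A = (\<Sum>p = 1..s. \<beta> p *\<^sub>M B p 0) +
      (\<Sum>p = 1..s. \<Sum>j = 1..m p - 1. ((-1) ^ (j - 1) / (of_nat j * \<alpha> p ^ j)) *\<^sub>M B p j)"
    by (simp add: sum.distrib)

  \<comment> \<open>The Taylor series of the identity \<open>[:0, 1:]\<close> satisfies \<open>F' = F * q'\<close>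
     to the required order at \<open>\<alpha> p\<close>, which identifies it as the limit.\<close>
  have coeff_lim: "(\<lambda>n. fps_nth (taylor_at (\<alpha> p) (exp_partial n q)) j)
      \<longlonglongrightarrow> fps_nth (taylor_at (\<alpha> p) [:0, 1:]) j" if p: "p \<in> {1..s}" and j: "j < m p" for p j
  proof (rule taylor_exp_partial_tendsto[where m = "m p"])
    have q_nth: "fps_nth (taylor_at (\<alpha> p) q) j = c p j" if "j < m p" for j
      unfolding q_def using assms(3) p that by (rule taylor_hermite_sum)
    have "poly q (\<alpha> p) = \<beta> p"
      using q_nth[of 0] j by (simp add: taylor_at_nth_0 c_def)
    then show "fps_nth (taylor_at (\<alpha> p) [:0, 1:]) 0 = exp (poly q (\<alpha> p))"
      using assms(5)[OF p] by (simp add: taylor_at_nth_0)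
    fix j assume "Suc j < m p"
    then have "fps_nth ((fps_X + fps_const (\<alpha> p)) * fps_deriv (taylor_at (\<alpha> p) q)) j
        = (if j = 0 then 1 else 0)"
      using assms(5)[OF p] q_nth by (intro log_series_ode[where m = "m p"]) (auto simp: c_def)
    then show "fps_nth (fps_deriv (taylor_at (\<alpha> p) [:0, 1:])) j
        = fps_nth (taylor_at (\<alpha> p) [:0, 1:] * fps_deriv (taylor_at (\<alpha> p) q)) j"
      by (simp add: taylor_at_linear)
  qed (fact j)

  have "(\<lambda>n. mat_poly (exp_partial n q) A) \<longlonglongrightarrow> mat_poly [:0, 1:] A"
    unfolding interpolation[of "exp_partial _ q"] interpolation[of "[:0, 1:]"] mat_scale_def
    by (intro tendsto_sum tendsto_vec_lambda tendsto_mult tendsto_const coeff_lim) auto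
  then have "mat_exp (mat_poly q A) = mat_poly [:0, 1:] A"
    using mat_poly_exp_partial_tendsto by (rule LIMSEQ_unique[rotated])
  also have "mat_poly [:0, 1:] A = A" by (simp add: mat_poly_pCons)
  finally show ?thesis unfolding is_mat_log_def q_A .
qed

end
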